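(* Let $A$ be an algebra over a field $\Bbbk$. For all $a,b,c,a_i,b_i\in A$ and $q,q',q'',q_i,\zeta\in\Bbbk$ ($1\le i\le n$) and $r\ge1$ we have: (1) ($q$-derivation properties) $$[a,bc]_{qq'}=[a,b]_qc+qb[a,c]_{q'},\qquad [ab,c]_{qq'}=a[b,c]_{q'}+q'[a,c]_qb,$$ $$[a,b_1\cdots b_n]_{q_1\cdots q_n}=\sum_{i=1}^nq_1\cdots q_{i-1}\,b_1\cdots b_{i-1}[a,b_i]_{q_i}b_{i+1}\cdots b_n,$$ $$[a_1\cdots a_n,b]_{q_1\cdots q_n}=\sum_{i=1}^nq_{i+1}\cdots q_n\,a_1\cdots a_{i-1}[a_i,b]_{q_i}a_{i+1}\cdots a_n.$$ (2) ($q$-Jacobi identity) $$\bigl[[a,b]_{q'},c\bigr]_{q''q}=\bigl[a,[b,c]_q\bigr]_{q'q''}-q'b[a,c]_{q''}+q[a,c]_{q''}b.$$ (3) ($q$-Leibniz formulas) $$[a,b^r]_{q^r}=\sum_{i=0}^{r-1}q^i\binom ri_\zeta b^i\bigl[\ldots\bigl[[a,\underbrace{b]_q,b\bigr]_{q\zeta}\ldots,b}_{r-i}\bigr]_{q\zeta^{r-i-1}},$$ $$[a^r,b]_{q^r}=\sum_{i=0}^{r-1}q^i\binom ri_\zeta\bigl[\underbrace{a,\ldots\bigl[a,[a}_{r-i},b]_q\bigr]_{q\zeta}\ldots\bigr]_{q\zeta^{r-i-1}}a^i.$$ (4) (restricted $q$-Leibniz formulas) If $\operatorname{char}\Bbbk=0$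 and $\operatorname{ord}\zeta=r$, or $\operatorname{char}\Bbbk=p>0$ and $p^k\operatorname{ord}\zeta=r$ for some integer $k\ge0$, then $$[a,b^r]_{q^r}=\bigl[\ldots\bigl[[a,\underbrace{b]_q,b\bigr]_{q\zeta}\ldots,b}_r\bigr]_{q\zeta^{r-1}},\qquad [a^r,b]_{q^r}=\bigl[\underbrace{a,\ldots\bigl[a,[a}_r,b]_q\bigr]_{q\zeta}\ldots\bigr]_{q\zeta^{r-1}}.$$
   Context: For $a,b\in A$ and $q\in\Bbbk$ the $q$-commutator is $[a,b]_q:=ab-qba$. For $q\in\Bbbk$ put $(n)_q=1+q+\dots+q^{n-1}$, $(n)_q!=(1)_q(2)_q\cdots(n)_q$, and let $\binom ni_q=\frac{(n)_q!}{(n-i)_q!(i)_q!}$ be the $q$-binomial coefficient ($0\le i\le n$), understood as a polynomial over $\mathbb Z$ evaluated at $q$. $\operatorname{ord}\zeta$ is the multiplicative order of $\zeta\in\Bbbk^\times$. In the iterated brackets, with $m=r-i$ (or $m=r$) copies of $b$ (resp. $a$), the $j$-th bracket counted from the inside ($1\le j\le m$) has parameter $q\zeta^{j-1}$. Powers with exponent $0$ and empty products are $1$. *)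

theory Defs
  imports "HOL-Computational_Algebra.Computational_Algebra"
begin

text \<open>
  The sort \<open>{ring, monoid_mult}\<close> (rather than \<open>ring_1\<close>, which demands \<open>0 \<noteq> 1\<close>) also admits the
  zero algebra.
\<close>

locale assoc_algebra = vector_space scale
  for scale :: "'k::field \<Rightarrow> 'a::{ring, monoid_mult} \<Rightarrow> 'a" +
  assumes scale_mult_left: "scale c x * y = scale c (x * y)"
    and scale_mult_right: "x * scale c y = scale c (x * y)"

definition q_comm :: "('k::field \<Rightarrow> 'a::{ring, monoid_mult} \<Rightarrow> 'a) \<Rightarrow> 'k \<Rightarrow> 'a \<Rightarrow> 'a \<Rightarrow> 'a" where
  "q_comm scale q a b = a * b - scale q (b * a)"

text \<open>
  In both iterated brackets with \<open>m\<close> copies of the repeated element, the \<open>j\<close>-th bracket counted from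
  the inside, \<open>1 \<le> j \<le> m\<close>, has parameter \<open>q \<zeta>\<^sup>j\<^sup>-\<^sup>1\<close>.
\<close>

primrec iter_comm_right ::
  "('k::field \<Rightarrow> 'a::{ring, monoid_mult} \<Rightarrow> 'a) \<Rightarrow> 'k \<Rightarrow> 'k \<Rightarrow> nat \<Rightarrow> 'a \<Rightarrow> 'a \<Rightarrow> 'a" where
  "iter_comm_right scale q \<zeta> 0 a b = a"
| "iter_comm_right scale q \<zeta> (Suc m) a b =
     q_comm scale (q * \<zeta> ^ m) (iter_comm_right scale q \<zeta> m a b) b"

primrec iter_comm_left ::
  "('k::field \<Rightarrow> 'a::{ring, monoid_mult} \<Rightarrow> 'a) \<Rightarrow> 'k \<Rightarrow> 'k \<Rightarrow> nat \<Rightarrow> 'a \<Rightarrow> 'a \<Rightarrow> 'a" where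
  "iter_comm_left scale q \<zeta> 0 a b = b"
| "iter_comm_left scale q \<zeta> (Suc m) a b =
     q_comm scale (q * \<zeta> ^ m) a (iter_comm_left scale q \<zeta> m a b)"

definition q_int :: "'b::comm_ring_1 \<Rightarrow> nat \<Rightarrow> 'b" where
  "q_int q n = (\<Sum>i<n. q ^ i)"

definition q_fact :: "'b::comm_ring_1 \<Rightarrow> nat \<Rightarrow> 'b" where
  "q_fact q n = (\<Prod>k=1..n. q_int q k)"

text \<open>
  The quotient of \<open>q\<close>-factorials is formed in \<open>\<int>[X]\<close>, where the division is exact for \<open>i \<le> n\<close> (see
  \<open>q_binom_poly_mult\<close> below), and only then evaluated: at a root of unity the
  denominator may vanish.
\<close>

definition q_binom_poly :: "nat \<Rightarrow> nat \<Rightarrow> int poly" where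
  "q_binom_poly n i =
     q_fact (monom 1 1) n div (q_fact (monom 1 1) (n - i) * q_fact (monom 1 1) i)"

definition q_binom :: "'k::field \<Rightarrow> nat \<Rightarrow> nat \<Rightarrow> 'k" where
  "q_binom q n i = poly (map_poly of_int (q_binom_poly n i)) q"

lemma q_int_add: "q_int q (m + n) = q_int q m + q ^ m * q_int q n"
  by (induction n) (simp_all add: q_int_def algebra_simps power_add)

lemma q_fact_0: "q_fact q 0 = 1"
  by (simp add: q_fact_def)

lemma q_fact_Suc: "q_fact q (Suc n) = q_fact q n * q_int q (Suc n)"
  by (simp add: q_fact_def mult.commute)

lemma q_fact_mult_dvd: "q_fact q m * q_fact q i dvd q_fact q (m + i)"
proof (induction "m + i" arbitrary: m i)
  case 0
  then show ?case by (simp add: q_fact_0)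
next
  case (Suc n)
  show ?case
  proof (cases "m = 0 \<or> i = 0")
    case True
    then show ?thesis by (auto simp: q_fact_0)
  next
    case False
    then obtain m' i' where m': "m = Suc m'" and i': "i = Suc i'"
      by (metis not0_implies_Suc)
    have "q_fact q m' * q_fact q i dvd q_fact q (m' + i)"
      using Suc(2) m' by (intro Suc(1)) simp
    then have 1: "q_fact q m * q_fact q i dvd q_fact q (m' + i) * q_int q m"
      unfolding m' q_fact_Suc by (metis mult.assoc mult.commute mult_dvd_mono dvd_refl)
    have "q_fact q m * q_fact q i' dvd q_fact q (m + i')"
      using Suc(2) i' by (intro Suc(1)) simp
    then have 2: "q_fact q m * q_fact q i dvd q_fact q (m + i') * q_int q i"
      unfolding i' q_fact_Suc by (metis mult.assoc mult_dvd_mono dvd_refl)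
    have "q_fact q (m + i) = q_fact q (m' + i) * q_int q (m + i)"
      using q_fact_Suc[of q "m' + i"] m' by simp
    also have "\<dots> = q_fact q (m' + i) * q_int q m + q ^ m * (q_fact q (m + i') * q_int q i)"
      unfolding q_int_add by (simp add: m' i' distrib_left mult.left_commute)
    finally show ?thesis
      using 1 2 by simp
  qed
qed

lemma q_binom_poly_mult:
  assumes "i \<le> n"
  shows "q_binom_poly n i * (q_fact (monom 1 1) (n - i) * q_fact (monom 1 1) i)
           = q_fact (monom 1 1) n"
  using q_fact_mult_dvd[of "monom 1 1 :: int poly" "n - i" i] assms
  by (simp add: q_binom_poly_def)

text \<open>
  The multiplicative order, with \<open>0\<close> standing for infinite order (and for \<open>\<zeta> = 0\<close>).
\<close>

definition mult_order :: "'k::field \<Rightarrow> nat" where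
  "mult_order \<zeta> =
     (if \<exists>d>0. \<zeta> ^ d = 1 then LEAST d. d > 0 \<and> \<zeta> ^ d = 1 else 0)"

end

theory Submission
  imports Defs
begin

text \<open>
  The \<open>q\<close>-Leibniz formulas follow from moving \<open>a\<close> past \<open>b\<close> one factor at a time: the definition of
  the iterated brackets gives a three-term recursion whose coefficients satisfy the \<open>q\<close>-Pascal rule.
  For the restricted formulas let \<open>d = ord \<zeta>\<close> and \<open>r = p\<^sup>k d\<close>. The coefficients \<open>binom(d, i)\<close> vanish
  at \<open>\<zeta>\<close> for \<open>0 < i < d\<close> because \<open>(i) binom(d, i) = (d) binom(d - 1, i - 1)\<close> and \<open>(d) = 0 \<noteq> (i)\<close>.
  By the \<open>q\<close>-binomial theorem this says that \<open>\<Prod>j<d. (1 + \<zeta>\<^sup>j X)\<close> has the form \<open>1 + c X\<^sup>d\<close>. As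
  \<open>\<zeta>\<^sup>j\<close> is \<open>d\<close>-periodic in \<open>j\<close>, the product over \<open>j < r\<close> is its \<open>p\<^sup>k\<close>-th power, which by Frobenius is
  again a binomial, so the inner coefficients \<open>binom(r, i)\<close> vanish as well.
\<close>

section \<open>Derivation properties and the Jacobi identity for q-commutators\<close>

context assoc_algebra
begin

lemma q_comm_mult_right:
  "q_comm scale (q * q') a (b * c) =
     q_comm scale q a b * c + scale q (b * q_comm scale q' a c)"
  by (simp add: q_comm_def algebra_simps scale_mult_left scale_mult_right)

lemma q_comm_mult_left:
  "q_comm scale (q * q') (a * b) c =
     a * q_comm scale q' b c + scale q' (q_comm scale q a c * b)"
  by (simp add: q_comm_def algebra_simps scale_mult_left scale_mult_right)

text \<open>Induction on \<open>n\<close> splits off the last factor by the two-factor rule. The old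
  terms only gain \<open>bs (Suc n)\<close> on the right; the new term is weighted by the product of
  all earlier parameters.\<close>

lemma q_comm_prod_list_right:
  "q_comm scale (\<Prod>i=1..n. qs i) a (prod_list (map bs [1..<Suc n])) =
     (\<Sum>i=1..n. scale (\<Prod>j=1..<i. qs j)
        (prod_list (map bs [1..<i]) * q_comm scale (qs i) a (bs i)
           * prod_list (map bs [Suc i..<Suc n])))"
proof (induction n)
  case 0
  show ?case by (simp add: q_comm_def)
next
  case (Suc n)
  have "q_comm scale (\<Prod>i=1..Suc n. qs i) a (prod_list (map bs [1..<Suc (Suc n)])) =
      q_comm scale ((\<Prod>i=1..n. qs i) * qs (Suc n)) a
        (prod_list (map bs [1..<Suc n]) * bs (Suc n))"
    by (simp add: mult.commute mult.assoc)
  also have "\<dots> = (\<Sum>i=1..n. scale (\<Prod>j=1..<i. qs j)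
        (prod_list (map bs [1..<i]) * q_comm scale (qs i) a (bs i)
           * prod_list (map bs [Suc i..<Suc n]))) * bs (Suc n)
      + scale (\<Prod>i=1..n. qs i)
          (prod_list (map bs [1..<Suc n]) * q_comm scale (qs (Suc n)) a (bs (Suc n)))"
    unfolding q_comm_mult_right Suc.IH ..
  also have "(\<Sum>i=1..n. scale (\<Prod>j=1..<i. qs j)
        (prod_list (map bs [1..<i]) * q_comm scale (qs i) a (bs i)
           * prod_list (map bs [Suc i..<Suc n]))) * bs (Suc n) =
      (\<Sum>i=1..n. scale (\<Prod>j=1..<i. qs j)
        (prod_list (map bs [1..<i]) * q_comm scale (qs i) a (bs i)
           * prod_list (map bs [Suc i..<Suc (Suc n)])))"
    unfolding sum_distrib_right by (intro sum.cong) (auto simp: scale_mult_left mult.assoc)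
  finally show ?case
    by (simp add: atLeastLessThanSuc_atLeastAtMost)
qed

text \<open>The last factor is split off again, but now the old terms also gain the weight
  \<open>qs (Suc n)\<close>, so the weights run over the indices above \<open>i\<close>.\<close>

lemma q_comm_prod_list_left:
  "q_comm scale (\<Prod>i=1..n. qs i) (prod_list (map as [1..<Suc n])) b =
     (\<Sum>i=1..n. scale (\<Prod>j=Suc i..n. qs j)
        (prod_list (map as [1..<i]) * q_comm scale (qs i) (as i) b
           * prod_list (map as [Suc i..<Suc n])))"
proof (induction n)
  case 0
  show ?case by (simp add: q_comm_def)
next
  case (Suc n)
  have "q_comm scale (\<Prod>i=1..Suc n. qs i) (prod_list (map as [1..<Suc (Suc n)])) b =
      q_comm scale ((\<Prod>i=1..n. qs i) * qs (Suc n))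
        (prod_list (map as [1..<Suc n]) * as (Suc n)) b"
    by (simp add: mult.commute mult.assoc)
  also have "\<dots> = prod_list (map as [1..<Suc n]) * q_comm scale (qs (Suc n)) (as (Suc n)) b
      + scale (qs (Suc n)) ((\<Sum>i=1..n. scale (\<Prod>j=Suc i..n. qs j)
        (prod_list (map as [1..<i]) * q_comm scale (qs i) (as i) b
           * prod_list (map as [Suc i..<Suc n]))) * as (Suc n))"
    unfolding q_comm_mult_left Suc.IH ..
  also have "scale (qs (Suc n)) ((\<Sum>i=1..n. scale (\<Prod>j=Suc i..n. qs j)
        (prod_list (map as [1..<i]) * q_comm scale (qs i) (as i) b
           * prod_list (map as [Suc i..<Suc n]))) * as (Suc n)) =
      (\<Sum>i=1..n. scale (\<Prod>j=Suc i..Suc n. qs j)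
        (prod_list (map as [1..<i]) * q_comm scale (qs i) (as i) b
           * prod_list (map as [Suc i..<Suc (Suc n)])))"
    unfolding sum_distrib_right scale_sum_right
    by (intro sum.cong) (auto simp: scale_mult_left mult.assoc)
  finally show ?case
    by (simp add: add.commute)
qed

lemma q_jacobi:
  "q_comm scale (q'' * q) (q_comm scale q' a b) c =
     q_comm scale (q' * q'') a (q_comm scale q b c)
       - scale q' (b * q_comm scale q'' a c) + scale q (q_comm scale q'' a c * b)"
  by (simp add: q_comm_def algebra_simps scale_mult_left scale_mult_right)

end

section \<open>Gaussian binomials in Z[X]: Pascal rule and absorption\<close>

lemma q_int_X_neq_0:
  assumes "n > 0"
  shows "q_int (monom 1 1 :: int poly) n \<noteq> 0"
proof
  assume "q_int (monom 1 1 :: int poly) n = 0"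
  \<comment> \<open>The value at 1 is the integer \<open>n\<close>. Nonvanishing is what later
    allows q-factorials to be cancelled in Z[X].\<close>
  then have "poly (q_int (monom 1 1 :: int poly) n) 1 = 0"
    by simp
  then show False
    using assms by (simp add: q_int_def poly_sum poly_monom)
qed

lemma q_fact_X_neq_0: "q_fact (monom 1 1 :: int poly) n \<noteq> 0"
  by (simp add: q_fact_def q_int_X_neq_0 del: One_nat_def)

lemma q_binom_poly_0_right [simp]: "q_binom_poly n 0 = 1"
  by (simp add: q_binom_poly_def q_fact_0 q_fact_X_neq_0 del: One_nat_def)

lemma q_binom_poly_self [simp]: "q_binom_poly n n = 1"
  by (simp add: q_binom_poly_def q_fact_0 q_fact_X_neq_0 del: One_nat_def)

text \<open>Split (n + 1) as (n - i) + X^(n - i) (i + 1), multiply by the factorial of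
  \<open>n\<close> and cancel the common factorials. The bound keeps \<open>Suc i\<close> at most
  \<open>n\<close>; beyond it truncated subtraction spoils the quotient, e.g.
  \<open>q_binom_poly 0 1\<close> is 1.\<close>

lemma q_binom_poly_Suc_Suc:
  assumes "i < n"
  shows "q_binom_poly (Suc n) (Suc i) =
    q_binom_poly n (Suc i) + monom 1 1 ^ (n - i) * q_binom_poly n i"
proof -
  let ?F = "q_fact (monom 1 1 :: int poly)" and ?I = "q_int (monom 1 1 :: int poly)"
  obtain m where n: "n = Suc (i + m)"
    using assms less_iff_Suc_add by auto
  have "q_binom_poly (Suc n) (Suc i) * (?F (Suc m) * ?F (Suc i)) = ?F n * ?I (Suc m + Suc i)"
    using q_binom_poly_mult[of "Suc i" "Suc n"] by (simp add: n q_fact_Suc[of _ "Suc (i + m)"] add.commute)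
  also have "\<dots> = ?F n * ?I (Suc m) + monom 1 1 ^ Suc m * (?F n * ?I (Suc i))"
    unfolding q_int_add by (simp add: algebra_simps)
  also have "?F n * ?I (Suc m) = q_binom_poly n (Suc i) * (?F (Suc m) * ?F (Suc i))"
    using q_binom_poly_mult[of "Suc i" n, symmetric]
    by (simp add: n q_fact_Suc[of _ m] mult_ac)
  also have "?F n * ?I (Suc i) = q_binom_poly n i * (?F (Suc m) * ?F (Suc i))"
    using q_binom_poly_mult[of i n, symmetric]
    by (simp add: n q_fact_Suc[of _ i] mult_ac)
  finally have "q_binom_poly (Suc n) (Suc i) * (?F (Suc m) * ?F (Suc i)) =
      (q_binom_poly n (Suc i) + monom 1 1 ^ (n - i) * q_binom_poly n i) * (?F (Suc m) * ?F (Suc i))"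
    by (simp add: n algebra_simps)
  then show ?thesis
    using q_fact_X_neq_0 by (simp del: One_nat_def)
qed

text \<open>After multiplication by the factorials of \<open>n - i\<close> and \<open>i\<close>,
  both sides become the factorial of \<open>Suc n\<close>.\<close>

lemma q_binom_poly_absorption:
  assumes "i \<le> n"
  shows "q_int (monom 1 1) (Suc i) * q_binom_poly (Suc n) (Suc i) =
    q_int (monom 1 1) (Suc n) * q_binom_poly n i"
proof -
  let ?F = "q_fact (monom 1 1 :: int poly)" and ?I = "q_int (monom 1 1 :: int poly)"
  have "?I (Suc i) * q_binom_poly (Suc n) (Suc i) * (?F (n - i) * ?F i) = ?F (Suc n)"
    using q_binom_poly_mult[of "Suc i" "Suc n"] assms
    by (simp add: q_fact_Suc[of _ i] mult_ac)
  also have "\<dots> = ?I (Suc n) * q_binom_poly n i * (?F (n - i) * ?F i)"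
    using q_binom_poly_mult[of i n, symmetric] assms
    by (simp add: q_fact_Suc mult_ac)
  finally show ?thesis
    using q_fact_X_neq_0 by (simp del: One_nat_def)
qed

section \<open>Transfer of the identities from Z[X] to values in a field\<close>

lemma poly_map_of_int_add:
  "poly (map_poly of_int (p + r)) (x :: 'k :: comm_ring_1) =
    poly (map_poly of_int p) x + poly (map_poly of_int r) x"
proof -
  have "map_poly (of_int :: int \<Rightarrow> 'k) (p + r) = map_poly of_int p + map_poly of_int r"
    by (rule poly_eqI) (simp add: coeff_map_poly)
  then show ?thesis by simp
qed

lemma poly_map_of_int_mult:
  "poly (map_poly of_int (p * r)) (x :: 'k :: comm_ring_1) =
    poly (map_poly of_int p) x * poly (map_poly of_int r) x"
  by (induction p) (simp_all add: map_poly_pCons map_poly_smult poly_map_of_int_add algebra_simps)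

lemma poly_map_of_int_X_power:
  "poly (map_poly of_int (monom 1 1 ^ n)) (x :: 'k :: comm_ring_1) = x ^ n"
  by (simp add: monom_power map_poly_monom poly_monom del: One_nat_def)

lemma poly_map_of_int_q_int:
  "poly (map_poly of_int (q_int (monom 1 1) n)) (x :: 'k :: comm_ring_1) = q_int x n"
proof (induction n)
  case 0
  then show ?case by (simp add: q_int_def)
next
  case (Suc n)
  have "q_int (monom 1 1 :: int poly) (Suc n) = q_int (monom 1 1) n + monom 1 1 ^ n"
    by (simp add: q_int_def)
  moreover have "q_int x (Suc n) = q_int x n + x ^ n"
    by (simp add: q_int_def)
  ultimately show ?case
    by (simp only: poly_map_of_int_add poly_map_of_int_X_power Suc.IH)
qed

lemma q_binom_0_right [simp]: "q_binom q n 0 = 1"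
  by (simp add: q_binom_def)

lemma q_binom_self [simp]: "q_binom q n n = 1"
  by (simp add: q_binom_def)

lemma q_binom_Suc_Suc:
  "i < n \<Longrightarrow> q_binom q (Suc n) (Suc i) = q_binom q n (Suc i) + q ^ (n - i) * q_binom q n i"
  by (simp only: q_binom_def q_binom_poly_Suc_Suc poly_map_of_int_add poly_map_of_int_mult poly_map_of_int_X_power)

lemma q_binom_absorption:
  "i \<le> n \<Longrightarrow> q_int q (Suc i) * q_binom q (Suc n) (Suc i) = q_int q (Suc n) * q_binom q n i"
  using q_binom_poly_absorption[of i n, THEN arg_cong, of "\<lambda>p. poly (map_poly of_int p) q"]
  by (simp only: q_binom_def poly_map_of_int_q_int poly_map_of_int_mult)

section \<open>The q-binomial theorem and vanishing coefficients at roots of unity\<close>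

lemma coeff_q_product:
  "coeff (\<Prod>j<n. [:1, q ^ j:]) i = (if i \<le> n then q ^ (i choose 2) * q_binom q n i else 0)"
proof (induction n arbitrary: i)
  case 0
  show ?case by (cases i) (simp_all add: binomial_eq_0)
next
  case (Suc n)
  show ?case
  proof (cases i)
    case 0
    then show ?thesis using Suc.IH[of 0] by (simp add: binomial_eq_0)
  next
    case (Suc m)
    have "coeff (\<Prod>j<Suc n. [:1, q ^ j:]) i =
        coeff (\<Prod>j<n. [:1, q ^ j:]) (Suc m) + q ^ n * coeff (\<Prod>j<n. [:1, q ^ j:]) m"
      by (simp add: Suc)
    also have "\<dots> = (if i \<le> Suc n then q ^ (i choose 2) * q_binom q (Suc n) i else 0)"
    proof -
      have ch: "Suc k choose 2 = k + (k choose 2)" for k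
        by (simp add: numeral_2_eq_2)
      consider "m < n" | "m = n" | "n < m" by linarith
      then show ?thesis
      proof cases
        case 1
        \<comment> \<open>The factor \<open>q ^ m\<close> raises the exponent
          \<open>m choose 2\<close> to \<open>Suc m choose 2\<close>; the rest is the weight in the
          Pascal rule.\<close>
        then have "q ^ n = q ^ m * q ^ (n - m)"
          by (simp flip: power_add)
        with 1 show ?thesis
          by (simp add: Suc Suc.IH ch q_binom_Suc_Suc power_add algebra_simps)
      qed (simp_all add: Suc Suc.IH ch power_add)
    qed
    finally show ?thesis .
  qed
qed

text \<open>For infinite order this rests on the default value 0.\<close>

lemma mult_order_power: "q ^ mult_order q = 1"
proof (cases "\<exists>d>0. q ^ d = 1")
  case True
  then have "\<exists>d. d > 0 \<and> q ^ d = 1" by blast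
  from LeastI_ex[OF this] show ?thesis
    by (simp add: mult_order_def)
next
  case False
  then show ?thesis unfolding mult_order_def by (simp only: if_False power_0)
qed

lemma power_neq_1_if_less_mult_order:
  assumes "0 < i" "i < mult_order q"
  shows "q ^ i \<noteq> 1"
  using assms by (auto simp: mult_order_def dest: not_less_Least split: if_splits)

lemma q_binom_mult_order_eq_0:
  assumes "0 < i" "i < mult_order q"
  shows "q_binom q (mult_order q) i = 0"
proof -
  obtain j where i: "i = Suc j"
    using assms gr0_implies_Suc by blast
  obtain m where m: "mult_order q = Suc m"
    using assms by (cases "mult_order q") auto
  \<comment> \<open>Then \<open>q_int q n\<close> is (q^n - 1)/(q - 1), which vanishes exactly when
    q^n = 1.\<close>
  have "q \<noteq> 1"
    using power_neq_1_if_less_mult_order[OF assms] by auto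
  then have "q_int q (mult_order q) = 0" "q_int q i \<noteq> 0"
    using mult_order_power[of q] power_neq_1_if_less_mult_order[OF assms]
    by (simp_all add: q_int_def geometric_sum)
  then show ?thesis
    using q_binom_absorption[of j m q] assms by (simp add: i m)
qed

lemma q_product_periodic:
  assumes "q ^ d = (1 :: 'k :: field)"
  shows "(\<Prod>j<m * d. [:1, q ^ j:]) = (\<Prod>j<d. [:1, q ^ j:]) ^ m"
proof (induction m)
  case (Suc m)
  have "{..<Suc m * d} = {..<m * d} \<union> {m * d..<m * d + d}"
    by auto
  then have "(\<Prod>j<Suc m * d. [:1, q ^ j:]) =
      (\<Prod>j<m * d. [:1, q ^ j:]) * (\<Prod>j=m * d..<m * d + d. [:1, q ^ j:])"
    by (simp add: prod.union_disjoint ivl_disj_int)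
  \<comment> \<open>Shifting the index by \<open>m * d\<close> changes no factor, because q^(m d) =
    1.\<close>
  also have "(\<Prod>j=m * d..<m * d + d. [:1, q ^ j:]) = (\<Prod>j<d. [:1, q ^ j:])"
    by (rule prod.reindex_bij_witness[of _ "\<lambda>j. j + m * d" "\<lambda>j. j - m * d"])
      (auto simp: power_add power_mult mult.commute[of m] assms le_iff_add)
  finally show ?case
    by (simp add: Suc.IH)
qed simp

lemma q_binom_char_power_mult_order_eq_0:
  fixes q :: "'k :: field"
  assumes "CHAR('k) > 0" "0 < i" "i < CHAR('k) ^ k * mult_order q"
  shows "q_binom q (CHAR('k) ^ k * mult_order q) i = 0"
proof -
  define d where "d = mult_order q"
  define c where "c = q ^ (d choose 2)"
  let ?N = "CHAR('k) ^ k"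
  \<comment> \<open>Infinite order, encoded as 0, would leave no room for \<open>i\<close>.\<close>
  have d: "d > 0"
    using assms(3) by (cases "d = 0") (auto simp: d_def)
  have qd: "q ^ d = 1"
    by (simp add: d_def mult_order_power)
  have prime: "prime CHAR('k poly)"
    using assms(1) by (simp add: prime_CHAR_semidom)
  have "(\<Prod>j<d. [:1, q ^ j:]) = 1 + monom c d"
  proof (rule poly_eqI)
    fix j
    consider "j = 0" | "0 < j" "j < d" | "j = d" | "d < j"
      by linarith
    then show "coeff (\<Prod>j<d. [:1, q ^ j:]) j = coeff (1 + monom c d) j"
    proof cases
      case 2
      then show ?thesis
        using q_binom_mult_order_eq_0[of j q] by (simp add: coeff_q_product d_def)
    qed (use d in \<open>simp_all add: coeff_q_product c_def binomial_eq_0\<close>)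
  qed
  then have "(\<Prod>j<?N * d. [:1, q ^ j:]) = (1 + monom c d) ^ ?N"
    by (simp add: q_product_periodic[OF qd])
  also have "\<dots> = 1 ^ ?N + monom c d ^ ?N"
    using prime by (intro freshmans_dream'[of _ k]) simp_all
  also have "\<dots> = 1 + monom (c ^ ?N) (?N * d)"
    by (simp add: monom_power mult.commute)
  finally have "coeff (\<Prod>j<?N * d. [:1, q ^ j:]) i = 0"
    using assms(2,3) by (simp add: d_def)
  \<comment> \<open>Needed to cancel the power of \<open>q\<close> that accompanies the binomial in
    \<open>coeff_q_product\<close>.\<close>
  moreover have "q \<noteq> 0"
    using qd d by (auto simp: power_0_left)
  ultimately show ?thesis
    using assms(3) by (simp add: coeff_q_product d_def)
qed

section \<open>The general and restricted q-Leibniz formulas\<close>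

context assoc_algebra
begin

text \<open>The regrouping common to the left and right expansions, hence stated for an arbitrary
  family \<open>X\<close>.\<close>

lemma sum_q_pascal:
  "(\<Sum>i\<le>r. scale (q ^ i * q_binom \<zeta> r i) (X i)
      + scale (q ^ Suc i * (\<zeta> ^ (r - i) * q_binom \<zeta> r i)) (X (Suc i))) =
   (\<Sum>i\<le>Suc r. scale (q ^ i * q_binom \<zeta> (Suc r) i) (X i))" (is "?L = ?R")
proof -
  let ?f = "\<lambda>i. scale (q ^ Suc i * q_binom \<zeta> r (Suc i)) (X (Suc i))"
  let ?g = "\<lambda>i. scale (q ^ Suc i * (\<zeta> ^ (r - i) * q_binom \<zeta> r i)) (X (Suc i))"
  let ?h = "\<lambda>i. scale (q ^ Suc i * q_binom \<zeta> (Suc r) (Suc i)) (X (Suc i))"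
  have "?L = (\<Sum>i<Suc r. scale (q ^ i * q_binom \<zeta> r i) (X i)) + (\<Sum>i<Suc r. ?g i)"
    unfolding sum.distrib lessThan_Suc_atMost ..
  \<comment> \<open>Peeling the first term of one sum and the last of the other aligns the
    remainders at \<open>X (Suc i)\<close> for \<open>i < r\<close>, where the Pascal rule applies.
    Both end coefficients involve only binomials equal to 1.\<close>
  also have "\<dots> = (X 0 + (\<Sum>i<r. ?f i)) + ((\<Sum>i<r. ?g i) + ?g r)"
    unfolding sum.lessThan_Suc_shift[of "\<lambda>i. scale (q ^ i * q_binom \<zeta> r i) (X i)"]
      sum.lessThan_Suc[of ?g] by simp
  also have "\<dots> = X 0 + (\<Sum>i<r. ?f i + ?g i) + ?h r"
    by (simp add: sum.distrib add.assoc)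
  also have "(\<Sum>i<r. ?f i + ?g i) = (\<Sum>i<r. ?h i)"
    by (intro sum.cong refl)
      (simp add: q_binom_Suc_Suc distrib_left flip: scale_left_distrib)
  also have "X 0 + (\<Sum>i<r. ?h i) + ?h r = X 0 + (\<Sum>i<Suc r. ?h i)"
    by (simp add: add.assoc)
  also have "\<dots> = ?R"
    unfolding sum.atMost_Suc_shift lessThan_Suc_atMost by simp
  finally show ?thesis .
qed

text \<open>Expanding the plain product is convenient for induction: the term \<open>i = r\<close>
  is exactly the one that the commutator with parameter \<open>q ^ r\<close> subtracts.\<close>

lemma mult_power_eq_sum_iter_comm_right:
  "a * b ^ r = (\<Sum>i\<le>r. scale (q ^ i * q_binom \<zeta> r i)
     (b ^ i * iter_comm_right scale q \<zeta> (r - i) a b))"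
proof (induction r)
  case 0
  show ?case by simp
next
  case (Suc r)
  let ?A = "\<lambda>m. iter_comm_right scale q \<zeta> m a b"
  \<comment> \<open>The bracket defining \<open>?A (Suc m)\<close>, solved for
    \<open>?A m * b\<close>.\<close>
  have step: "(b ^ i * ?A m) * b = b ^ i * ?A (Suc m) + scale (q * \<zeta> ^ m) (b ^ Suc i * ?A m)" for i m
    by (simp add: q_comm_def algebra_simps scale_mult_right power_Suc2 del: power_Suc)
  have "a * b ^ Suc r = (\<Sum>i\<le>r. scale (q ^ i * q_binom \<zeta> r i) (b ^ i * ?A (r - i))) * b"
    by (simp add: Suc.IH[symmetric] power_Suc2 mult.assoc del: power_Suc)
  also have "\<dots> = (\<Sum>i\<le>r. scale (q ^ i * q_binom \<zeta> r i) (b ^ i * ?A (Suc r - i))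
      + scale (q ^ Suc i * (\<zeta> ^ (r - i) * q_binom \<zeta> r i)) (b ^ Suc i * ?A (Suc r - Suc i)))"
    unfolding sum_distrib_right
  proof (intro sum.cong refl)
    fix i assume "i \<in> {..r}"
    then show "scale (q ^ i * q_binom \<zeta> r i) (b ^ i * ?A (r - i)) * b =
        scale (q ^ i * q_binom \<zeta> r i) (b ^ i * ?A (Suc r - i))
        + scale (q ^ Suc i * (\<zeta> ^ (r - i) * q_binom \<zeta> r i)) (b ^ Suc i * ?A (Suc r - Suc i))"
      unfolding scale_mult_left step
      by (simp add: Suc_diff_le scale_right_distrib mult_ac(2,3)
          del: iter_comm_right.simps power_Suc(1)) (simp add: mult_ac)
  qed
  also have "\<dots> = (\<Sum>i\<le>Suc r. scale (q ^ i * q_binom \<zeta> (Suc r) i) (b ^ i * ?A (Suc r - i)))"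
    by (rule sum_q_pascal)
  finally show ?case .
qed

text \<open>The mirror image: the new factor \<open>a\<close> enters on the left and the powers of
  \<open>a\<close> collect on the right.\<close>

lemma power_mult_eq_sum_iter_comm_left:
  "a ^ r * b = (\<Sum>i\<le>r. scale (q ^ i * q_binom \<zeta> r i)
     (iter_comm_left scale q \<zeta> (r - i) a b * a ^ i))"
proof (induction r)
  case 0
  show ?case by simp
next
  case (Suc r)
  let ?A = "\<lambda>m. iter_comm_left scale q \<zeta> m a b"
  have step: "a * (?A m * a ^ i) = ?A (Suc m) * a ^ i + scale (q * \<zeta> ^ m) (?A m * a ^ Suc i)" for i m
    by (simp add: q_comm_def algebra_simps scale_mult_left)
  have "a ^ Suc r * b = a * (\<Sum>i\<le>r. scale (q ^ i * q_binom \<zeta> r i) (?A (r - i) * a ^ i))"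
    by (simp add: Suc.IH[symmetric] mult.assoc)
  also have "\<dots> = (\<Sum>i\<le>r. scale (q ^ i * q_binom \<zeta> r i) (?A (Suc r - i) * a ^ i)
      + scale (q ^ Suc i * (\<zeta> ^ (r - i) * q_binom \<zeta> r i)) (?A (Suc r - Suc i) * a ^ Suc i))"
    unfolding sum_distrib_left
  proof (intro sum.cong refl)
    fix i assume "i \<in> {..r}"
    then show "a * scale (q ^ i * q_binom \<zeta> r i) (?A (r - i) * a ^ i) =
        scale (q ^ i * q_binom \<zeta> r i) (?A (Suc r - i) * a ^ i)
        + scale (q ^ Suc i * (\<zeta> ^ (r - i) * q_binom \<zeta> r i)) (?A (Suc r - Suc i) * a ^ Suc i)"
      unfolding scale_mult_right step
      by (simp add: Suc_diff_le scale_right_distrib mult_ac(2,3)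
          del: iter_comm_left.simps power_Suc(1)) (simp add: mult_ac)
  qed
  also have "\<dots> = (\<Sum>i\<le>Suc r. scale (q ^ i * q_binom \<zeta> (Suc r) i) (?A (Suc r - i) * a ^ i))"
    by (rule sum_q_pascal)
  finally show ?case .
qed

lemma q_leibniz_right:
  "q_comm scale (q ^ r) a (b ^ r) =
     (\<Sum>i<r. scale (q ^ i * q_binom \<zeta> r i) (b ^ i * iter_comm_right scale q \<zeta> (r - i) a b))"
  by (simp add: q_comm_def mult_power_eq_sum_iter_comm_right[of a b r q \<zeta>]
      flip: lessThan_Suc_atMost)

lemma q_leibniz_left:
  "q_comm scale (q ^ r) (a ^ r) b =
     (\<Sum>i<r. scale (q ^ i * q_binom \<zeta> r i) (iter_comm_left scale q \<zeta> (r - i) a b * a ^ i))"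
  by (simp add: q_comm_def power_mult_eq_sum_iter_comm_left[of a r b q \<zeta>]
      flip: lessThan_Suc_atMost)

text \<open>Once the inner coefficients vanish, only the term \<open>i = 0\<close> survives, with
  coefficient 1. The condition on the characteristic enters only through
  \<open>vanish\<close>.\<close>

lemma q_leibniz_restricted:
  assumes "r \<ge> 1" and vanish: "\<And>i. 0 < i \<Longrightarrow> i < r \<Longrightarrow> q_binom \<zeta> r i = 0"
  shows "q_comm scale (q ^ r) a (b ^ r) = iter_comm_right scale q \<zeta> r a b"
    and "q_comm scale (q ^ r) (a ^ r) b = iter_comm_left scale q \<zeta> r a b"
proof -
  have *: "(\<Sum>i<r. scale (q ^ i * q_binom \<zeta> r i) (X i)) = X 0" for X
  proof -
    have "(\<Sum>i<r. scale (q ^ i * q_binom \<zeta> r i) (X i)) =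
        (\<Sum>i\<in>{0}. scale (q ^ i * q_binom \<zeta> r i) (X i))"
      using assms by (intro sum.mono_neutral_right) auto
    then show ?thesis by simp
  qed
  show "q_comm scale (q ^ r) a (b ^ r) = iter_comm_right scale q \<zeta> r a b"
    unfolding q_leibniz_right[of q r a b \<zeta>] * by simp
  show "q_comm scale (q ^ r) (a ^ r) b = iter_comm_left scale q \<zeta> r a b"
    unfolding q_leibniz_left[of q r a b \<zeta>] * by simp
qed

end

theorem proposition1p2:
  fixes scale :: "'k::field \<Rightarrow> 'a::{ring, monoid_mult} \<Rightarrow> 'a"
    and a b c :: 'a and as bs :: "nat \<Rightarrow> 'a"
    and q q' q'' \<zeta> :: 'k and qs :: "nat \<Rightarrow> 'k"
    and n r :: nat
  assumes "assoc_algebra scale"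
    and "r \<ge> 1"
  shows
    "(q_comm scale (q * q') a (b * c) =
        q_comm scale q a b * c + scale q (b * q_comm scale q' a c) \<and>
      q_comm scale (q * q') (a * b) c =
        a * q_comm scale q' b c + scale q' (q_comm scale q a c * b) \<and>
      q_comm scale (\<Prod>i=1..n. qs i) a (prod_list (map bs [1..<Suc n])) =
        (\<Sum>i=1..n. scale (\<Prod>j=1..<i. qs j)
           (prod_list (map bs [1..<i]) * q_comm scale (qs i) a (bs i)
              * prod_list (map bs [Suc i..<Suc n]))) \<and>
      q_comm scale (\<Prod>i=1..n. qs i) (prod_list (map as [1..<Suc n])) b =
        (\<Sum>i=1..n. scale (\<Prod>j=Suc i..n. qs j)
           (prod_list (map as [1..<i]) * q_comm scale (qs i) (as i) b
              * prod_list (map as [Suc i..<Suc n])))) \<and>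
     (q_comm scale (q'' * q) (q_comm scale q' a b) c =
        q_comm scale (q' * q'') a (q_comm scale q b c)
          - scale q' (b * q_comm scale q'' a c) + scale q (q_comm scale q'' a c * b)) \<and>
     (q_comm scale (q ^ r) a (b ^ r) =
        (\<Sum>i=0..r-1. scale (q ^ i * q_binom \<zeta> r i)
           (b ^ i * iter_comm_right scale q \<zeta> (r - i) a b)) \<and>
      q_comm scale (q ^ r) (a ^ r) b =
        (\<Sum>i=0..r-1. scale (q ^ i * q_binom \<zeta> r i)
           (iter_comm_left scale q \<zeta> (r - i) a b * a ^ i))) \<and>
     ((CHAR('k) = 0 \<and> mult_order \<zeta> = r) \<or>
      (CHAR('k) > 0 \<and> (\<exists>k. CHAR('k) ^ k * mult_order \<zeta> = r)) \<longrightarrow>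
        q_comm scale (q ^ r) a (b ^ r) = iter_comm_right scale q \<zeta> r a b \<and>
        q_comm scale (q ^ r) (a ^ r) b = iter_comm_left scale q \<zeta> r a b)"
proof -
  interpret assoc_algebra scale by fact
  \<comment> \<open>This fails for \<open>r = 0\<close>, where truncated subtraction would leave the
    index 0 on the left.\<close>
  have range: "{0..r - 1} = {..<r}"
    using assms(2) by auto
  have vanish: "q_binom \<zeta> r i = 0"
    if "(CHAR('k) = 0 \<and> mult_order \<zeta> = r) \<or>
      (CHAR('k) > 0 \<and> (\<exists>k. CHAR('k) ^ k * mult_order \<zeta> = r))" "0 < i" "i < r" for i
    using that q_binom_mult_order_eq_0 q_binom_char_power_mult_order_eq_0 by blast
  show ?thesis
    unfolding range
    by (intro conjI impI q_comm_mult_right q_comm_mult_left q_comm_prod_list_right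
        q_comm_prod_list_left q_jacobi q_leibniz_right q_leibniz_left
        q_leibniz_restricted[OF assms(2) vanish])
qed

end
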